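(* Let $E$ be a separable Banach space, $\mathcal{X}$ a decomposable normed subspace of $L_0(\Omega,E)$, $f:\Omega\times E\to\overline{\mathbb{R}}$ a measurable integrand, and $\mathcal{B}$ a solid bornology on $\mathcal{X}$. Let $x_0\in\mathcal{X}$ with $I_f(x_0)$ finite, and let $x^*\in\mathcal{X}^*\cap L_0(\Omega,E^*_{\sigma^*})$. Then the following assertions are equivalent: (a) $x^*$ is a $\mathcal{B}$-subderivative of $I_f$ at $x_0$; (b) for every $B\in\mathcal{B}$, $\displaystyle\lim_{r\to0_+}\ \sup_{x\in B}\int_\Omega [f-\langle x^*,\cdot\rangle]^-(x_0,x,r)\,d\mu=0.$
   Context: $(\Omega,\mathbb{T},\mu)$ is a measure space with $\mu$ a $\sigma$-finite positive measure and $\mathbb{T}$ $\mu$-complete. $L_0(\Omega,E)$ is the space of classes (a.e. equality) of measurable functions $\Omega\to E$. A measurable integrand is a $\mathbb{T}\otimes\mathcal{B}(E)$-measurable function $f:\Omega\times E\to\overline{\mathbb{R}}$. $I_f(x)=\int^*_\Omega f(\omega,x(\omega))\,d\mu(\omega)$ with $\int^*_\Omega v\,d\mu=\inf\{\int_\Omega u\,d\mu: u\in L_1(\Omega,\mathbb{R}),\ u\ge v\text{ a.e.}\}$. $\mathcal{X}$ is decomposable if $x1_A+y1_{A^c}\in\mathcal{X}$ for all $x,y\in\mathcal{X}$, $A\in\mathbb{T}$. $L_0(\Omega,E^*_{\sigma^*})$ is the set of classes of scalarly measurable functions $x^*:\Omega\to E^*$ (i.e. $\langle x^*(\cdot),e\rangle$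 measurable for all $e\in E$); $x^*\in\mathcal{X}^*\cap L_0(\Omega,E^*_{\sigma^*})$ means that $x\mapsto\int_\Omega\langle x^*(\omega),x(\omega)\rangle\,d\mu$ is a well-defined continuous linear functional on $\mathcal{X}$. Differential quotients: $[f](x_0,x,r)$ is the function $\omega\mapsto r^{-1}(f(\omega,x_0(\omega)+rx(\omega))-f(\omega,x_0(\omega)))$; $[f-\langle x^*,\cdot\rangle](x_0,x,r)=[f](x_0,x,r)-\langle x^*,x\rangle$; $[\,\cdot\,]^-$ denotes the negative part. For a functional $J$ on $\mathcal{X}$ finite at $x_0$, $[J](x_0,x,r)=r^{-1}(J(x_0+rx)-J(x_0))$. A bornology on $\mathcal{X}$ is a family $\mathcal{B}$ of subsets of $\mathcal{X}$ which covers $\mathcal{X}$, is stable under finite unions and hereditary (subsets of members are members). It is solid if for every $X\in\mathcal{B}$, $\{x1_A: x\in X,\ A\in\mathbb{T}\}\in\mathcal{B}$. $x^*\in\mathcal{X}^*$ is a $\mathcal{B}$-subderivative of $J$ at $x_0$ ($J$ finite at $x_0$) if for every $X\in\mathcal{B}$, $\liminf_{r\to0_+}\inf_{x\in X}([J](x_0,x,r)-\langle x^*,x\rangle)\ge0$. *)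

theory Defs
  imports "HOL-Analysis.Analysis"
begin

text \<open>
  Classes modulo almost everywhere equality are handled through representatives: a set of classes
  is given by its full preimage in \<^term>\<open>borel_measurable M\<close>, that is, by a set of measurable
  functions closed under a.e. modification. A norm on classes is then a function on
  representatives which vanishes exactly on the functions that are a.e. zero; the triangle
  inequality makes it invariant under a.e. modification.
\<close>

definition subspace_L0 ::
  "'a measure \<Rightarrow> ('a \<Rightarrow> 'e::{banach, second_countable_topology}) set \<Rightarrow> bool" where
  "subspace_L0 M X \<longleftrightarrow>
     X \<subseteq> borel_measurable M \<and>
     (\<forall>x\<in>X. \<forall>y\<in>borel_measurable M. (AE \<omega> in M. y \<omega> = x \<omega>) \<longrightarrow> y \<in> X) \<and>
     (\<lambda>\<omega>. 0) \<in> X \<and>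
     (\<forall>x\<in>X. \<forall>y\<in>X. (\<lambda>\<omega>. x \<omega> + y \<omega>) \<in> X) \<and>
     (\<forall>c. \<forall>x\<in>X. (\<lambda>\<omega>. c *\<^sub>R x \<omega>) \<in> X)"

definition norm_on ::
  "'a measure \<Rightarrow> ('a \<Rightarrow> 'e::{banach, second_countable_topology}) set \<Rightarrow>
   (('a \<Rightarrow> 'e) \<Rightarrow> real) \<Rightarrow> bool" where
  "norm_on M X N \<longleftrightarrow>
     (\<forall>x\<in>X. 0 \<le> N x) \<and>
     (\<forall>x\<in>X. N x = 0 \<longleftrightarrow> (AE \<omega> in M. x \<omega> = 0)) \<and>
     (\<forall>x\<in>X. \<forall>y\<in>X. N (\<lambda>\<omega>. x \<omega> + y \<omega>) \<le> N x + N y) \<and>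
     (\<forall>c. \<forall>x\<in>X. N (\<lambda>\<omega>. c *\<^sub>R x \<omega>) = \<bar>c\<bar> * N x)"

definition normed_subspace_L0 ::
  "'a measure \<Rightarrow> ('a \<Rightarrow> 'e::{banach, second_countable_topology}) set \<Rightarrow>
   (('a \<Rightarrow> 'e) \<Rightarrow> real) \<Rightarrow> bool" where
  "normed_subspace_L0 M X N \<longleftrightarrow> subspace_L0 M X \<and> norm_on M X N"

definition restr :: "('a \<Rightarrow> 'e::real_vector) \<Rightarrow> 'a set \<Rightarrow> 'a \<Rightarrow> 'e" where
  "restr x A = (\<lambda>\<omega>. indicator A \<omega> *\<^sub>R x \<omega>)"

definition decomposable :: "'a measure \<Rightarrow> ('a \<Rightarrow> 'e::real_vector) set \<Rightarrow> bool" where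
  "decomposable M X \<longleftrightarrow>
     (\<forall>x\<in>X. \<forall>y\<in>X. \<forall>A\<in>sets M. (\<lambda>\<omega>. restr x A \<omega> + restr y (space M - A) \<omega>) \<in> X)"

definition measurable_integrand ::
  "'a measure \<Rightarrow> ('a \<Rightarrow> 'e::topological_space \<Rightarrow> ereal) \<Rightarrow> bool" where
  "measurable_integrand M f \<longleftrightarrow>
     (\<lambda>(\<omega>, e). f \<omega> e) \<in> borel_measurable (M \<Otimes>\<^sub>M borel)"

definition upper_integral :: "'a measure \<Rightarrow> ('a \<Rightarrow> ereal) \<Rightarrow> ereal" where
  "upper_integral M v =
     Inf {ereal (\<integral>\<omega>. u \<omega> \<partial>M) | u. integrable M u \<and> (AE \<omega> in M. v \<omega> \<le> ereal (u \<omega>))}"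

definition integral_functional ::
  "'a measure \<Rightarrow> ('a \<Rightarrow> 'e \<Rightarrow> ereal) \<Rightarrow> ('a \<Rightarrow> 'e) \<Rightarrow> ereal" where
  "integral_functional M f x = upper_integral M (\<lambda>\<omega>. f \<omega> (x \<omega>))"

definition dual_space ::
  "('a \<Rightarrow> 'e::real_vector) set \<Rightarrow> (('a \<Rightarrow> 'e) \<Rightarrow> real) \<Rightarrow> (('a \<Rightarrow> 'e) \<Rightarrow> real) set" where
  "dual_space X N = {\<phi>.
     (\<forall>x\<in>X. \<forall>y\<in>X. \<phi> (\<lambda>\<omega>. x \<omega> + y \<omega>) = \<phi> x + \<phi> y) \<and>
     (\<forall>c. \<forall>x\<in>X. \<phi> (\<lambda>\<omega>. c *\<^sub>R x \<omega>) = c * \<phi> x) \<and>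
     (\<forall>x\<in>X. \<forall>\<epsilon>>0. \<exists>\<delta>>0. \<forall>y\<in>X. N (\<lambda>\<omega>. y \<omega> - x \<omega>) < \<delta> \<longrightarrow> \<bar>\<phi> y - \<phi> x\<bar> < \<epsilon>)}"

definition scalarly_measurable ::
  "'a measure \<Rightarrow> ('a \<Rightarrow> 'e::real_normed_vector \<Rightarrow>\<^sub>L real) \<Rightarrow> bool" where
  "scalarly_measurable M xs \<longleftrightarrow>
     (\<forall>e. (\<lambda>\<omega>. blinfun_apply (xs \<omega>) e) \<in> borel_measurable M)"

definition pairing ::
  "'a measure \<Rightarrow> ('a \<Rightarrow> 'e::real_normed_vector \<Rightarrow>\<^sub>L real) \<Rightarrow> ('a \<Rightarrow> 'e) \<Rightarrow> real" where
  "pairing M xs x = (\<integral>\<omega>. blinfun_apply (xs \<omega>) (x \<omega>) \<partial>M)"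

text \<open>The integrability clause is what makes the functional well defined; without it the
  Bochner integral would silently be \<^term>\<open>0\<close>.\<close>

definition integral_dual ::
  "'a measure \<Rightarrow> ('a \<Rightarrow> 'e::real_normed_vector) set \<Rightarrow> (('a \<Rightarrow> 'e) \<Rightarrow> real) \<Rightarrow>
   ('a \<Rightarrow> 'e \<Rightarrow>\<^sub>L real) set" where
  "integral_dual M X N = {xs. scalarly_measurable M xs \<and>
     (\<forall>x\<in>X. integrable M (\<lambda>\<omega>. blinfun_apply (xs \<omega>) (x \<omega>))) \<and>
     pairing M xs \<in> dual_space X N}"

text \<open>The last clause is heredity for sets of classes: it contains heredity for sets of
  representatives, and it makes membership depend only on the classes a set represents.\<close>

definition bornology ::
  "'a measure \<Rightarrow> ('a \<Rightarrow> 'e) set \<Rightarrow> ('a \<Rightarrow> 'e) set set \<Rightarrow> bool" where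
  "bornology M X \<B> \<longleftrightarrow>
     \<Union>\<B> = X \<and>
     (\<forall>B\<in>\<B>. \<forall>C\<in>\<B>. B \<union> C \<in> \<B>) \<and>
     (\<forall>B\<in>\<B>. \<forall>C. C \<subseteq> X \<and> (\<forall>y\<in>C. \<exists>x\<in>B. AE \<omega> in M. y \<omega> = x \<omega>) \<longrightarrow> C \<in> \<B>)"

definition solid :: "'a measure \<Rightarrow> ('a \<Rightarrow> 'e::real_vector) set set \<Rightarrow> bool" where
  "solid M \<B> \<longleftrightarrow> (\<forall>B\<in>\<B>. {restr x A | x A. x \<in> B \<and> A \<in> sets M} \<in> \<B>)"

definition functional_quotient ::
  "(('a \<Rightarrow> 'e::real_vector) \<Rightarrow> ereal) \<Rightarrow> ('a \<Rightarrow> 'e) \<Rightarrow> ('a \<Rightarrow> 'e) \<Rightarrow> real \<Rightarrow> ereal" where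
  "functional_quotient J x0 x r = ereal (inverse r) * (J (\<lambda>\<omega>. x0 \<omega> + r *\<^sub>R x \<omega>) - J x0)"

definition integrand_quotient ::
  "('a \<Rightarrow> 'e::real_vector \<Rightarrow> ereal) \<Rightarrow> ('a \<Rightarrow> 'e) \<Rightarrow> ('a \<Rightarrow> 'e) \<Rightarrow> real \<Rightarrow> 'a \<Rightarrow> ereal" where
  "integrand_quotient f x0 x r \<omega> =
     ereal (inverse r) * (f \<omega> (x0 \<omega> + r *\<^sub>R x \<omega>) - f \<omega> (x0 \<omega>))"

definition tilted_quotient ::
  "('a \<Rightarrow> 'e::real_normed_vector \<Rightarrow> ereal) \<Rightarrow> ('a \<Rightarrow> 'e \<Rightarrow>\<^sub>L real) \<Rightarrow>
   ('a \<Rightarrow> 'e) \<Rightarrow> ('a \<Rightarrow> 'e) \<Rightarrow> real \<Rightarrow> 'a \<Rightarrow> ereal" where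
  "tilted_quotient f xs x0 x r \<omega> =
     integrand_quotient f x0 x r \<omega> - ereal (blinfun_apply (xs \<omega>) (x \<omega>))"

definition neg_part :: "ereal \<Rightarrow> ereal" where
  "neg_part t = max 0 (- t)"

definition subderivative ::
  "('a \<Rightarrow> 'e::real_vector) set \<Rightarrow> (('a \<Rightarrow> 'e) \<Rightarrow> real) \<Rightarrow> ('a \<Rightarrow> 'e) set set \<Rightarrow>
   (('a \<Rightarrow> 'e) \<Rightarrow> ereal) \<Rightarrow> ('a \<Rightarrow> 'e) \<Rightarrow> (('a \<Rightarrow> 'e) \<Rightarrow> real) \<Rightarrow> bool" where
  "subderivative X N \<B> J x0 \<phi> \<longleftrightarrow>
     x0 \<in> X \<and> \<bar>J x0\<bar> \<noteq> \<infinity> \<and> \<phi> \<in> dual_space X N \<and>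
     (\<forall>B\<in>\<B>. 0 \<le> Liminf (at_right 0)
        (\<lambda>r. INF x\<in>B. functional_quotient J x0 x r - ereal (\<phi> x)))"

end

theory Submission
  imports Defs
begin

text \<open>
  Write \<open>q x r\<close> for the tilted quotient and \<open>U\<close> for the upper integral. Both conditions of the
  equivalence are statements about \<open>q\<close> alone.

  Since \<open>I\<^sub>f\<close> is finite at \<open>x0\<close>, the function \<open>\<omega> \<mapsto> f \<omega> (x0 \<omega>)\<close> is almost everywhere equal to an
  integrable real function (\<open>upper_integral_finite_imp_integrable\<close>). The upper integral commutes
  with increasing affine maps whose translation part is integrable (\<open>upper_integral_affine\<close>), so the
  difference quotient of \<open>I\<^sub>f\<close> minus \<open>\<langle>x*, x\<rangle>\<close> is \<open>U (q x r)\<close>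
  (\<open>functional_quotient_eq_upper_integral\<close>). The subderivative condition therefore says that the
  infimum of \<open>U (q x r)\<close> over \<open>x \<in> B\<close> has nonnegative lower limit for every \<open>B\<close>.

  One implication is the bound \<open>U v \<ge> - \<integral> v\<^sup>-\<close>. For the other, fix \<open>x \<in> B\<close> and let \<open>A\<close> be the set where
  \<open>q x r < 0\<close>. Replacing \<open>x\<close> by its restriction to \<open>A\<close> leaves \<open>q\<close> unchanged on \<open>A\<close> and makes it
  vanish almost everywhere else, so the new quotient is \<open>- (q x r)\<^sup>-\<close> and its upper integral is
  \<open>- \<integral> (q x r)\<^sup>-\<close> (\<open>neg_part_integral_eq_upper_integral_restr\<close>). As \<open>A\<close> depends on \<open>x\<close> and \<open>r\<close>, all
  these restrictions are collected in the solid hull of \<open>B\<close>, which is a member of the bornology; its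
  infimum is at most minus the supremum of \<open>\<integral> (q x r)\<^sup>-\<close> over \<open>B\<close>.

  Behind both directions is the formula \<open>U (- g) = - \<integral> g\<close> for measurable \<open>g \<ge> 0\<close>
  (\<open>upper_integral_uminus\<close>), where \<open>\<sigma>\<close>-finiteness enters: if \<open>\<integral> g = \<infinity>\<close> there must be integrable
  minorants of \<open>g\<close> with arbitrarily large integral.
\<close>

section \<open>The upper integral\<close>

lemma ereal_le_uminus_swap: "a \<le> - b \<longleftrightarrow> b \<le> - a" for a b :: ereal
  by (cases a; cases b) auto

lemma upper_integral_le:
  assumes "integrable M u" and "AE \<omega> in M. v \<omega> \<le> ereal (u \<omega>)"
  shows "upper_integral M v \<le> ereal (\<integral>\<omega>. u \<omega> \<partial>M)"
  unfolding upper_integral_def using assms by (intro Inf_lower) blast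

lemma upper_integral_greatest:
  assumes "\<And>u. integrable M u \<Longrightarrow> (AE \<omega> in M. v \<omega> \<le> ereal (u \<omega>)) \<Longrightarrow> z \<le> ereal (\<integral>\<omega>. u \<omega> \<partial>M)"
  shows "z \<le> upper_integral M v"
  unfolding upper_integral_def using assms by (intro Inf_greatest) blast

lemma upper_integral_mono_AE:
  assumes "AE \<omega> in M. v \<omega> \<le> w \<omega>"
  shows "upper_integral M v \<le> upper_integral M w"
proof (rule upper_integral_greatest)
  fix u assume "integrable M u" "AE \<omega> in M. w \<omega> \<le> ereal (u \<omega>)"
  moreover from this(2) assms have "AE \<omega> in M. v \<omega> \<le> ereal (u \<omega>)"
    by eventually_elim (rule order_trans)
  ultimately show "upper_integral M v \<le> ereal (\<integral>\<omega>. u \<omega> \<partial>M)"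
    by (intro upper_integral_le)
qed

lemma upper_integral_cong_AE:
  assumes "AE \<omega> in M. v \<omega> = w \<omega>"
  shows "upper_integral M v = upper_integral M w"
  using assms by (intro antisym upper_integral_mono_AE) (auto elim: eventually_mono)

lemma upper_integral_affine_le:
  assumes c: "0 < c" and a: "integrable M a"
  shows "upper_integral M (\<lambda>\<omega>. ereal c * v \<omega> + ereal (a \<omega>))
    \<le> ereal c * upper_integral M v + ereal (\<integral>\<omega>. a \<omega> \<partial>M)"
    (is "?U \<le> _")
proof -
  have "(?U - ereal (\<integral>\<omega>. a \<omega> \<partial>M)) / ereal c \<le> upper_integral M v"
  proof (rule upper_integral_greatest)
    fix u assume u: "integrable M u" "AE \<omega> in M. v \<omega> \<le> ereal (u \<omega>)"
    from u(2) have "AE \<omega> in M. ereal c * v \<omega> + ereal (a \<omega>) \<le> ereal (c * u \<omega> + a \<omega>)"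
    proof eventually_elim
      case (elim \<omega>)
      then show ?case using c by (cases "v \<omega>") auto
    qed
    then have "?U \<le> ereal (\<integral>\<omega>. c * u \<omega> + a \<omega> \<partial>M)"
      using u(1) a by (intro upper_integral_le) auto
    also have "(\<integral>\<omega>. c * u \<omega> + a \<omega> \<partial>M) = c * (\<integral>\<omega>. u \<omega> \<partial>M) + (\<integral>\<omega>. a \<omega> \<partial>M)"
      using u(1) a by simp
    finally show "(?U - ereal (\<integral>\<omega>. a \<omega> \<partial>M)) / ereal c \<le> ereal (\<integral>\<omega>. u \<omega> \<partial>M)"
      using c by (cases ?U) (auto simp: field_simps)
  qed
  then show ?thesis
    using c by (cases ?U; cases "upper_integral M v") (auto simp: field_simps)
qed

text \<open>The map \<open>v \<mapsto> c v + a\<close> has an inverse of the same form, so the inequality just shown, applied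
  to that inverse, is also the reverse inequality.\<close>

lemma upper_integral_affine:
  assumes c: "0 < c" and a: "integrable M a"
  shows "upper_integral M (\<lambda>\<omega>. ereal c * v \<omega> + ereal (a \<omega>))
    = ereal c * upper_integral M v + ereal (\<integral>\<omega>. a \<omega> \<partial>M)"
    (is "upper_integral M ?w = _")
proof (rule antisym[OF upper_integral_affine_le[OF assms]])
  have inv: "ereal (1 / c) * ?w \<omega> + ereal (- a \<omega> / c) = v \<omega>" for \<omega>
    using c by (cases "v \<omega>") (auto simp: field_simps)
  have "upper_integral M v \<le> ereal (1 / c) * upper_integral M ?w + ereal (\<integral>\<omega>. - a \<omega> / c \<partial>M)"
    using upper_integral_affine_le[of "1 / c" M "\<lambda>\<omega>. - a \<omega> / c" ?w] c a unfolding inv by simp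
  then show "ereal c * upper_integral M v + ereal (\<integral>\<omega>. a \<omega> \<partial>M) \<le> upper_integral M ?w"
    using c by (cases "upper_integral M ?w"; cases "upper_integral M v") (auto simp: field_simps)
qed

lemma ereal_integral_le_nn_integral:
  assumes "integrable M w"
  shows "ereal (\<integral>\<omega>. w \<omega> \<partial>M) \<le> enn2ereal (\<integral>\<^sup>+\<omega>. ennreal (w \<omega>) \<partial>M)"
proof -
  have "(\<integral>\<omega>. w \<omega> \<partial>M) \<le> (\<integral>\<omega>. max 0 (w \<omega>) \<partial>M)"
    using assms by (intro integral_mono) auto
  also have "ereal (\<integral>\<omega>. max 0 (w \<omega>) \<partial>M) = enn2ereal (\<integral>\<^sup>+\<omega>. ennreal (max 0 (w \<omega>)) \<partial>M)"
    using assms by (subst nn_integral_eq_integral) (auto simp: enn2ereal_ennreal)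
  finally show ?thesis
    by (simp add: ennreal_max_0 max.commute)
qed

text \<open>The lower bound on \<open>?U\<close> compares \<open>- u\<close> with \<open>g\<close> for an integrable majorant \<open>u\<close> of \<open>- g\<close>. For the
  upper bound, \<open>g\<close> is the increasing limit of the truncations \<open>min n g\<close> restricted to sets of finite
  measure exhausting the space. Each truncation is integrable, so its negative is an admissible
  majorant of \<open>- g\<close>, and monotone convergence gives the claim even when \<open>\<integral> g = \<infinity>\<close>.\<close>

lemma (in sigma_finite_measure) upper_integral_uminus:
  assumes [measurable]: "g \<in> borel_measurable M"
  shows "upper_integral M (\<lambda>\<omega>. - enn2ereal (g \<omega>)) = - enn2ereal (\<integral>\<^sup>+\<omega>. g \<omega> \<partial>M)"
    (is "?U = _")
proof (rule antisym)
  show "- enn2ereal (\<integral>\<^sup>+\<omega>. g \<omega> \<partial>M) \<le> ?U"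
  proof (rule upper_integral_greatest)
    fix u assume u: "integrable M u" "AE \<omega> in M. - enn2ereal (g \<omega>) \<le> ereal (u \<omega>)"
    from u(2) have "AE \<omega> in M. ennreal (- u \<omega>) \<le> g \<omega>"
    proof eventually_elim
      case (elim \<omega>)
      then show ?case
        by (cases "g \<omega>") (auto simp: enn2ereal_ennreal ennreal_leI)
    qed
    then have "(\<integral>\<^sup>+\<omega>. ennreal (- u \<omega>) \<partial>M) \<le> (\<integral>\<^sup>+\<omega>. g \<omega> \<partial>M)"
      by (rule nn_integral_mono_AE)
    then have "ereal (\<integral>\<omega>. - u \<omega> \<partial>M) \<le> enn2ereal (\<integral>\<^sup>+\<omega>. g \<omega> \<partial>M)"
      using ereal_integral_le_nn_integral[of M "\<lambda>\<omega>. - u \<omega>"] u(1)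
      by (simp add: less_eq_ennreal.rep_eq)
    then show "- enn2ereal (\<integral>\<^sup>+\<omega>. g \<omega> \<partial>M) \<le> ereal (\<integral>\<omega>. u \<omega> \<partial>M)"
      using u(1) by (simp add: ereal_uminus_le_reorder[of "enn2ereal _"])
  qed
next
  obtain A :: "nat \<Rightarrow> 'a set" where A: "range A \<subseteq> sets M" "(\<Union>i. A i) = space M"
    "\<And>i. emeasure M (A i) \<noteq> \<infinity>" "incseq A"
    by (rule sigma_finite_incseq) blast
  have [measurable]: "A n \<in> sets M" for n
    using A(1) by auto
  define h where "h n \<omega> = min (of_nat n) (g \<omega>) * indicator (A n) \<omega>" for n \<omega>
  have [measurable]: "h n \<in> borel_measurable M" for n
    unfolding h_def by measurable
  have h_le: "h n \<omega> \<le> g \<omega>" for n \<omega>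
    by (auto simp: h_def indicator_def)
  have "incseq h"
    using A(4) unfolding h_def incseq_def le_fun_def
    by (auto intro!: min.mono simp: indicator_def intro: min.coboundedI1 of_nat_mono)
  have sup_h: "(SUP n. h n \<omega>) = g \<omega>" if \<omega>: "\<omega> \<in> space M" for \<omega>
  proof (rule antisym)
    show "(SUP n. h n \<omega>) \<le> g \<omega>"
      using h_le by (intro SUP_least) auto
    obtain m where m: "\<omega> \<in> A m"
      using A(2) \<omega> by auto
    have bound: "min (of_nat n) (g \<omega>) \<le> (SUP n. h n \<omega>)" for n
    proof -
      have "\<omega> \<in> A (max m n)"
        using m A(4) by (meson incseqD max.cobounded1 subsetD)
      then have "min (of_nat n) (g \<omega>) \<le> h (max m n) \<omega>"
        by (auto simp: h_def min_le_iff_disj)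
      also have "\<dots> \<le> (SUP n. h n \<omega>)"
        by (intro SUP_upper) auto
      finally show ?thesis .
    qed
    show "g \<omega> \<le> (SUP n. h n \<omega>)"
    proof (rule dense_le)
      fix y assume y: "y < g \<omega>"
      then have "y < top"
        by (metis top.not_eq_extremum less_asym)
      then obtain n where "y < of_nat n"
        using ennreal_Ex_less_of_nat by blast
      with y have "y \<le> min (of_nat n) (g \<omega>)"
        by auto
      then show "y \<le> (SUP n. h n \<omega>)"
        using bound order_trans by blast
    qed
  qed
  have U_le: "?U \<le> - enn2ereal (\<integral>\<^sup>+\<omega>. h n \<omega> \<partial>M)" for n
  proof -
    have "(\<integral>\<^sup>+\<omega>. h n \<omega> \<partial>M) \<le> (\<integral>\<^sup>+\<omega>. of_nat n * indicator (A n) \<omega> \<partial>M)"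
      by (intro nn_integral_mono) (auto simp: h_def indicator_def)
    also have "\<dots> < top"
      using A(3)[of n] by (auto simp: nn_integral_cmult_indicator ennreal_mult_less_top top.not_eq_extremum of_nat_less_top)
    finally have fin: "(\<integral>\<^sup>+\<omega>. h n \<omega> \<partial>M) < top" .
    have h_real: "h n \<omega> = ennreal (enn2real (h n \<omega>))" for \<omega>
      by (auto simp: h_def indicator_def intro!: ennreal_enn2real[symmetric]) (metis min.strict_coboundedI1 ennreal_of_nat_eq_real_of_nat ennreal_less_top)
    have int: "integrable M (\<lambda>\<omega>. enn2real (h n \<omega>))"
      using fin h_real by (intro integrableI_nonneg) auto
    have "(\<integral>\<^sup>+\<omega>. h n \<omega> \<partial>M) = ennreal (\<integral>\<omega>. enn2real (h n \<omega>) \<partial>M)"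
      using nn_integral_eq_integral[OF int] h_real by simp
    then have eq: "- enn2ereal (\<integral>\<^sup>+\<omega>. h n \<omega> \<partial>M) = ereal (\<integral>\<omega>. - enn2real (h n \<omega>) \<partial>M)"
      by (simp add: enn2ereal_ennreal)
    have "- enn2ereal (g \<omega>) \<le> ereal (- enn2real (h n \<omega>))" for \<omega>
    proof -
      have "enn2ereal (h n \<omega>) \<le> enn2ereal (g \<omega>)"
        using h_le by (simp add: less_eq_ennreal.rep_eq)
      then show ?thesis
        by (subst (asm) h_real) (simp add: enn2ereal_ennreal ereal_uminus_le_reorder[of "enn2ereal _"])
    qed
    then show ?thesis
      unfolding eq using int by (intro upper_integral_le) auto
  qed
  have U_nonneg: "0 \<le> - ?U"
    using U_le[of 0] by (simp add: h_def ereal_uminus_le_reorder zero_ennreal.rep_eq)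
  have "(\<integral>\<^sup>+\<omega>. g \<omega> \<partial>M) = (\<integral>\<^sup>+\<omega>. (SUP n. h n \<omega>) \<partial>M)"
    using sup_h by (intro nn_integral_cong) auto
  also have "\<dots> = (SUP n. \<integral>\<^sup>+\<omega>. h n \<omega> \<partial>M)"
    using \<open>incseq h\<close> by (intro nn_integral_monotone_convergence_SUP) auto
  also have "\<dots> \<le> e2ennreal (- ?U)"
  proof (rule SUP_least)
    fix n
    have "enn2ereal (\<integral>\<^sup>+\<omega>. h n \<omega> \<partial>M) \<le> - ?U"
      using U_le[of n] by (subst ereal_le_uminus_swap)
    then show "(\<integral>\<^sup>+\<omega>. h n \<omega> \<partial>M) \<le> e2ennreal (- ?U)"
      using e2ennreal_mono by fastforce
  qed
  finally have "enn2ereal (\<integral>\<^sup>+\<omega>. g \<omega> \<partial>M) \<le> - ?U"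
    using U_nonneg by (simp add: less_eq_ennreal.rep_eq enn2ereal_e2ennreal)
  then show "?U \<le> - enn2ereal (\<integral>\<^sup>+\<omega>. g \<omega> \<partial>M)"
    by (subst ereal_le_uminus_swap)
qed

text \<open>If \<open>u\<close> is an integrable majorant of \<open>v\<close>, then \<open>U v - \<integral> u = U (v - u) = - \<integral> (u - v)\<close>. Finiteness
  of \<open>U v\<close> thus forces the nonnegative function \<open>u - v\<close> to have finite integral, and \<open>v\<close> is the
  difference of two integrable functions. If instead the negative part of \<open>v\<close> has infinite integral,
  the same formula gives \<open>U v = - \<infinity>\<close>.\<close>

lemma (in sigma_finite_measure) upper_integral_finite_imp_integrable:
  assumes [measurable]: "v \<in> borel_measurable M" and fin: "\<bar>upper_integral M v\<bar> \<noteq> \<infinity>"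
  obtains a where "integrable M a" "AE \<omega> in M. v \<omega> = ereal (a \<omega>)"
    "upper_integral M v = ereal (\<integral>\<omega>. a \<omega> \<partial>M)"
proof -
  obtain u where u: "integrable M u" "AE \<omega> in M. v \<omega> \<le> ereal (u \<omega>)"
  proof (rule ccontr)
    assume "\<not> thesis"
    with that have "top \<le> upper_integral M v"
      by (intro upper_integral_greatest) blast
    with fin show False
      by (simp add: top_ereal_def)
  qed
  note [measurable] = borel_measurable_integrable[OF u(1)]
  define g where "g \<omega> = e2ennreal (ereal (u \<omega>) - v \<omega>)" for \<omega>
  have [measurable]: "g \<in> borel_measurable M"
    unfolding g_def by measurable
  \<comment> \<open>The factor \<open>ereal 1\<close> brings \<open>v - u\<close> into the affine form \<open>c v + a\<close>.\<close>
  have "AE \<omega> in M. ereal 1 * v \<omega> + ereal (- u \<omega>) = - enn2ereal (g \<omega>)"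
    using u(2)
  proof eventually_elim
    case (elim \<omega>)
    then show ?case
      unfolding g_def by (subst enn2ereal_e2ennreal) (cases "v \<omega>"; auto)+
  qed
  from upper_integral_cong_AE[OF this]
  have eq: "upper_integral M v + ereal (\<integral>\<omega>. - u \<omega> \<partial>M) = - enn2ereal (\<integral>\<^sup>+\<omega>. g \<omega> \<partial>M)"
    using upper_integral_affine[of 1 M "\<lambda>\<omega>. - u \<omega>" v] u(1)
    by (simp add: upper_integral_uminus one_ereal_def[symmetric])
  have g_fin: "(\<integral>\<^sup>+\<omega>. g \<omega> \<partial>M) \<noteq> \<infinity>"
    using eq fin by (cases "upper_integral M v") auto
  have g_AE: "AE \<omega> in M. g \<omega> \<noteq> \<infinity>"
    using g_fin by (intro nn_integral_PInf_AE) auto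
  have g_int: "integrable M (\<lambda>\<omega>. enn2real (g \<omega>))"
  proof (rule integrableI_nonneg)
    have "(\<integral>\<^sup>+\<omega>. ennreal (enn2real (g \<omega>)) \<partial>M) = (\<integral>\<^sup>+\<omega>. g \<omega> \<partial>M)"
      using g_AE by (intro nn_integral_cong_AE) (auto elim!: eventually_mono simp: top.not_eq_extremum)
    then show "(\<integral>\<^sup>+\<omega>. ennreal (enn2real (g \<omega>)) \<partial>M) < \<infinity>"
      using g_fin by (simp add: top.not_eq_extremum)
  qed auto
  define a where "a \<omega> = u \<omega> - enn2real (g \<omega>)" for \<omega>
  have a_int: "integrable M a"
    unfolding a_def using u(1) g_int by auto
  have va: "AE \<omega> in M. v \<omega> = ereal (a \<omega>)"
    using u(2) g_AE
  proof eventually_elim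
    case (elim \<omega>)
    then show ?case
      by (cases "v \<omega>") (auto simp: g_def a_def ennreal.abs_eq[symmetric] ennreal_def[symmetric] ennreal_eq_0_iff enn2real_ennreal)
  qed
  have "upper_integral M v = upper_integral M (\<lambda>\<omega>. ereal 1 * 0 + ereal (a \<omega>))"
    using va by (intro upper_integral_cong_AE) auto
  also have "\<dots> = upper_integral M (\<lambda>\<omega>. 0) + ereal (\<integral>\<omega>. a \<omega> \<partial>M)"
    using upper_integral_affine[of 1 M a "\<lambda>_. 0"] a_int by (simp add: one_ereal_def[symmetric])
  also have "upper_integral M (\<lambda>\<omega>. 0) = 0"
    using upper_integral_uminus[of "\<lambda>_. 0"] by (simp add: zero_ennreal.rep_eq)
  finally show thesis
    using that a_int va by simp
qed

section \<open>Difference quotients\<close>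

definition neg_part_integral ::
  "'a measure \<Rightarrow> ('a \<Rightarrow> 'e::real_normed_vector \<Rightarrow> ereal) \<Rightarrow> ('a \<Rightarrow> 'e \<Rightarrow>\<^sub>L real) \<Rightarrow>
   ('a \<Rightarrow> 'e) \<Rightarrow> ('a \<Rightarrow> 'e) \<Rightarrow> real \<Rightarrow> ennreal" where
  "neg_part_integral M f xs x0 x r =
     (\<integral>\<^sup>+\<omega>. e2ennreal (neg_part (tilted_quotient f xs x0 x r \<omega>)) \<partial>M)"

lemma measurable_integrand_compose:
  assumes "measurable_integrand M f" and "x \<in> borel_measurable M"
  shows "(\<lambda>\<omega>. f \<omega> (x \<omega>)) \<in> borel_measurable M"
proof -
  have "(\<lambda>\<omega>. (\<omega>, x \<omega>)) \<in> M \<rightarrow>\<^sub>M M \<Otimes>\<^sub>M borel"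
    using assms(2) by measurable
  from measurable_compose[OF this assms(1)[unfolded measurable_integrand_def]]
  show ?thesis
    by simp
qed

lemma tilted_quotient_measurable:
  fixes x :: "'a \<Rightarrow> 'e::{real_normed_vector, second_countable_topology}"
  assumes f: "measurable_integrand M f"
    and [measurable]: "x0 \<in> borel_measurable M" "x \<in> borel_measurable M"
      "(\<lambda>\<omega>. blinfun_apply (xs \<omega>) (x \<omega>)) \<in> borel_measurable M"
  shows "tilted_quotient f xs x0 x r \<in> borel_measurable M"
proof -
  have "(\<lambda>\<omega>. x0 \<omega> + r *\<^sub>R x \<omega>) \<in> borel_measurable M"
    by measurable
  note [measurable] = measurable_integrand_compose[OF f this]
    measurable_integrand_compose[OF f \<open>x0 \<in> borel_measurable M\<close>]
  show ?thesis
    unfolding tilted_quotient_def integrand_quotient_def by measurable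
qed

lemma enn2ereal_neg_part [simp]: "enn2ereal (e2ennreal (neg_part t)) = neg_part t"
  by (simp add: neg_part_def enn2ereal_e2ennreal)

text \<open>With \<open>f \<omega> (x0 \<omega>) = a \<omega>\<close> real and integrable, the tilted quotient is the affine image
  \<open>v / r + d\<close> of \<open>v = f \<omega> (x0 \<omega> + r x \<omega>)\<close>, where \<open>d = - a / r - \<langle>x*, x\<rangle>\<close> is integrable. The function \<open>v\<close>
  itself may be infinite on a set of positive measure.\<close>

lemma (in sigma_finite_measure) functional_quotient_eq_upper_integral:
  assumes f: "measurable_integrand M f" and x0: "x0 \<in> borel_measurable M"
    and fin: "\<bar>integral_functional M f x0\<bar> \<noteq> \<infinity>" and r: "0 < r"
    and b: "integrable M (\<lambda>\<omega>. blinfun_apply (xs \<omega>) (x \<omega>))"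
  shows "functional_quotient (integral_functional M f) x0 x r - ereal (pairing M xs x)
    = upper_integral M (tilted_quotient f xs x0 x r)"
proof -
  obtain a where a: "integrable M a" "AE \<omega> in M. f \<omega> (x0 \<omega>) = ereal (a \<omega>)"
    and Ia: "upper_integral M (\<lambda>\<omega>. f \<omega> (x0 \<omega>)) = ereal (\<integral>\<omega>. a \<omega> \<partial>M)"
    using fin unfolding integral_functional_def
    by (rule upper_integral_finite_imp_integrable[OF measurable_integrand_compose[OF f x0]])
  define d where "d \<omega> = - (inverse r * a \<omega>) - blinfun_apply (xs \<omega>) (x \<omega>)" for \<omega>
  have d: "integrable M d" "(\<integral>\<omega>. d \<omega> \<partial>M) = - (inverse r * (\<integral>\<omega>. a \<omega> \<partial>M)) - pairing M xs x"
    unfolding d_def pairing_def using a(1) b by auto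
  have "AE \<omega> in M. tilted_quotient f xs x0 x r \<omega>
      = ereal (inverse r) * f \<omega> (x0 \<omega> + r *\<^sub>R x \<omega>) + ereal (d \<omega>)"
    using a(2)
  proof eventually_elim
    case (elim \<omega>)
    then show ?case
      using r unfolding tilted_quotient_def integrand_quotient_def d_def
      by (cases "f \<omega> (x0 \<omega> + r *\<^sub>R x \<omega>)") (auto simp: algebra_simps)
  qed
  from upper_integral_cong_AE[OF this]
  have "upper_integral M (tilted_quotient f xs x0 x r)
      = ereal (inverse r) * integral_functional M f (\<lambda>\<omega>. x0 \<omega> + r *\<^sub>R x \<omega>) + ereal (\<integral>\<omega>. d \<omega> \<partial>M)"
    unfolding integral_functional_def
    using r d(1) by (simp add: upper_integral_affine)
  also have "\<dots> = functional_quotient (integral_functional M f) x0 x r - ereal (pairing M xs x)"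
    using r unfolding functional_quotient_def d(2) integral_functional_def Ia
    by (cases "upper_integral M (\<lambda>\<omega>. f \<omega> (x0 \<omega> + r *\<^sub>R x \<omega>))") (auto simp: algebra_simps)
  finally show ?thesis ..
qed

lemma (in sigma_finite_measure) upper_integral_ge_neg_part:
  assumes "v \<in> borel_measurable M"
  shows "- enn2ereal (\<integral>\<^sup>+\<omega>. e2ennreal (neg_part (v \<omega>)) \<partial>M) \<le> upper_integral M v"
proof -
  have [measurable]: "(\<lambda>\<omega>. e2ennreal (neg_part (v \<omega>))) \<in> borel_measurable M"
    using assms unfolding neg_part_def by measurable
  have "- neg_part t \<le> t" for t
    unfolding neg_part_def by (metis ereal_uminus_le_reorder max.cobounded2)
  then show ?thesis
    by (subst upper_integral_uminus[symmetric]) (auto intro!: upper_integral_mono_AE)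
qed

text \<open>Cutting \<open>x\<close> down to the set where the quotient is negative turns the quotient into minus its
  own negative part. Off \<open>A\<close> the quotient of the restriction is \<open>f \<omega> (x0 \<omega>) - f \<omega> (x0 \<omega>)\<close> up to a
  factor, which is \<open>0\<close> only where \<open>f \<omega> (x0 \<omega>)\<close> is finite.\<close>

lemma (in sigma_finite_measure) neg_part_integral_eq_upper_integral_restr:
  fixes x :: "'a \<Rightarrow> 'e::{real_normed_vector, second_countable_topology}" and r :: real
  assumes f: "measurable_integrand M f"
    and x0: "x0 \<in> borel_measurable M" and x: "x \<in> borel_measurable M"
    and b: "(\<lambda>\<omega>. blinfun_apply (xs \<omega>) (x \<omega>)) \<in> borel_measurable M"
    and fin: "AE \<omega> in M. \<bar>f \<omega> (x0 \<omega>)\<bar> \<noteq> \<infinity>"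
  defines "A \<equiv> {\<omega> \<in> space M. tilted_quotient f xs x0 x r \<omega> < 0}"
  shows "upper_integral M (tilted_quotient f xs x0 (restr x A) r)
    = - enn2ereal (neg_part_integral M f xs x0 x r)"
proof -
  note [measurable] = tilted_quotient_measurable[OF f x0 x b, of r]
  have "AE \<omega> in M. tilted_quotient f xs x0 (restr x A) r \<omega>
      = - enn2ereal (e2ennreal (neg_part (tilted_quotient f xs x0 x r \<omega>)))"
    using fin AE_space
  proof eventually_elim
    case (elim \<omega>)
    show ?case
    proof (cases "\<omega> \<in> A")
      case True
      then have "tilted_quotient f xs x0 (restr x A) r \<omega> = tilted_quotient f xs x0 x r \<omega>"
        by (simp add: tilted_quotient_def integrand_quotient_def restr_def)
      moreover have "neg_part (tilted_quotient f xs x0 x r \<omega>) = - tilted_quotient f xs x0 x r \<omega>"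
        using True by (auto simp: A_def neg_part_def max_def)
      ultimately show ?thesis
        by (subst enn2ereal_neg_part) simp
    next
      case False
      then have "tilted_quotient f xs x0 (restr x A) r \<omega> = 0"
        using elim by (cases "f \<omega> (x0 \<omega>)")
          (auto simp: tilted_quotient_def integrand_quotient_def restr_def zero_ereal_def)
      moreover have "neg_part (tilted_quotient f xs x0 x r \<omega>) = 0"
        using False elim by (auto simp: A_def neg_part_def max_def)
      ultimately show ?thesis
        by (subst enn2ereal_neg_part) simp
    qed
  qed
  from upper_integral_cong_AE[OF this] show ?thesis
    unfolding neg_part_integral_def by (simp only:) (rule upper_integral_uminus, unfold neg_part_def, measurable)
qed

text \<open>Brings the limit of a nonnegative quantity into the \<open>Liminf\<close> form in which subderivatives are
  defined, so that the two conditions can be compared by monotonicity of \<open>Liminf\<close>.\<close>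

lemma tendsto_0_iff_Liminf_uminus_enn2ereal:
  fixes S :: "'b \<Rightarrow> ennreal"
  assumes "F \<noteq> bot"
  shows "(S \<longlongrightarrow> 0) F \<longleftrightarrow> 0 \<le> Liminf F (\<lambda>r. - enn2ereal (S r))"
proof -
  have "(S \<longlongrightarrow> 0) F \<longleftrightarrow> ((\<lambda>r. enn2ereal (S r)) \<longlongrightarrow> 0) F"
    using tendsto_enn2ereal_iff[of S 0 F] by (simp add: zero_ennreal.rep_eq)
  also have "\<dots> \<longleftrightarrow> Limsup F (\<lambda>r. enn2ereal (S r)) \<le> 0"
  proof
    assume "((\<lambda>r. enn2ereal (S r)) \<longlongrightarrow> 0) F"
    then show "Limsup F (\<lambda>r. enn2ereal (S r)) \<le> 0"
      using lim_imp_Limsup[OF assms] by force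
  next
    assume L: "Limsup F (\<lambda>r. enn2ereal (S r)) \<le> 0"
    have l: "0 \<le> Liminf F (\<lambda>r. enn2ereal (S r))"
      by (intro Liminf_bounded) auto
    have "Liminf F (\<lambda>r. enn2ereal (S r)) \<le> Limsup F (\<lambda>r. enn2ereal (S r))"
      by (rule Liminf_le_Limsup[OF assms])
    with L l show "((\<lambda>r. enn2ereal (S r)) \<longlongrightarrow> 0) F"
      by (intro Liminf_eq_Limsup[OF assms]) auto
  qed
  also have "\<dots> \<longleftrightarrow> 0 \<le> Liminf F (\<lambda>r. - enn2ereal (S r))"
    using assms by (subst ereal_Liminf_uminus) (metis ereal_0_le_uminus_iff)
  finally show ?thesis .
qed

section \<open>Subderivatives of integral functionals\<close>

theorem theorem9p2:
  fixes M :: "'a measure"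
    and X :: "('a \<Rightarrow> 'e::{banach, second_countable_topology}) set"
    and N :: "('a \<Rightarrow> 'e) \<Rightarrow> real"
    and f :: "'a \<Rightarrow> 'e \<Rightarrow> ereal"
    and \<B> :: "('a \<Rightarrow> 'e) set set"
    and x0 :: "'a \<Rightarrow> 'e"
    and xs :: "'a \<Rightarrow> 'e \<Rightarrow>\<^sub>L real"
  assumes "sigma_finite_measure M" and "complete_measure M"
    and "normed_subspace_L0 M X N" and "decomposable M X"
    and "measurable_integrand M f"
    and "bornology M X \<B>" and "solid M \<B>"
    and "x0 \<in> X" and "\<bar>integral_functional M f x0\<bar> \<noteq> \<infinity>"
    and "xs \<in> integral_dual M X N"
  shows "subderivative X N \<B> (integral_functional M f) x0 (pairing M xs) \<longleftrightarrow>
    (\<forall>B\<in>\<B>. ((\<lambda>r. SUP x\<in>B. \<integral>\<^sup>+\<omega>. e2ennreal (neg_part (tilted_quotient f xs x0 x r \<omega>)) \<partial>M)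
       \<longlongrightarrow> 0) (at_right 0))"
proof -
  interpret sigma_finite_measure M by fact
  define J where "J = integral_functional M f"
  define L where "L B r = (INF x\<in>B. functional_quotient J x0 x r - ereal (pairing M xs x))" for B r
  define S where "S B r = (SUP x\<in>B. neg_part_integral M f xs x0 x r)" for B r
  have meas: "x \<in> borel_measurable M" if "x \<in> X" for x
    using assms(3) that by (auto simp: normed_subspace_L0_def subspace_L0_def)
  have int: "integrable M (\<lambda>\<omega>. blinfun_apply (xs \<omega>) (x \<omega>))" if "x \<in> X" for x
    using assms(10) that by (auto simp: integral_dual_def)
  have sub: "B \<subseteq> X" if "B \<in> \<B>" for B
    using assms(6) that by (auto simp: bornology_def)
  have tq: "tilted_quotient f xs x0 x r \<in> borel_measurable M" if "x \<in> X" for x r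
    using that by (intro tilted_quotient_measurable assms meas borel_measurable_integrable int)
  have quot: "functional_quotient J x0 x r - ereal (pairing M xs x)
      = upper_integral M (tilted_quotient f xs x0 x r)" if "x \<in> X" "0 < r" for x r
    unfolding J_def using that
    by (intro functional_quotient_eq_upper_integral assms meas int)
  have fin: "AE \<omega> in M. \<bar>f \<omega> (x0 \<omega>)\<bar> \<noteq> \<infinity>"
  proof -
    have "\<bar>upper_integral M (\<lambda>\<omega>. f \<omega> (x0 \<omega>))\<bar> \<noteq> \<infinity>"
      using assms(9) by (simp only: integral_functional_def not_False_eq_True)
    then obtain a where "AE \<omega> in M. f \<omega> (x0 \<omega>) = ereal (a \<omega>)"
      by (rule upper_integral_finite_imp_integrable[OF
          measurable_integrand_compose[OF assms(5) meas[OF assms(8)]]])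
    then show ?thesis
      by eventually_elim simp
  qed
  have lower: "- enn2ereal (S B r) \<le> L B r" if "B \<in> \<B>" "0 < r" for B r
    unfolding L_def
  proof (rule INF_greatest)
    fix x assume x: "x \<in> B"
    then have "x \<in> X"
      using sub that by auto
    have "enn2ereal (neg_part_integral M f xs x0 x r) \<le> enn2ereal (S B r)"
      unfolding S_def less_eq_ennreal.rep_eq[symmetric] using x by (rule SUP_upper)
    then have "- enn2ereal (S B r) \<le> - enn2ereal (neg_part_integral M f xs x0 x r)"
      by simp
    also have "\<dots> \<le> upper_integral M (tilted_quotient f xs x0 x r)"
      unfolding neg_part_integral_def
      by (rule upper_integral_ge_neg_part[OF tq[OF \<open>x \<in> X\<close>]])
    finally show "- enn2ereal (S B r) \<le> functional_quotient J x0 x r - ereal (pairing M xs x)"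
      using quot[OF \<open>x \<in> X\<close> \<open>0 < r\<close>] by simp
  qed
  \<comment> \<open>For empty \<open>B\<close> this would fail: the infimum is then \<open>\<infinity>\<close>, but the supremum is \<open>0\<close>.\<close>
  have upper: "L {restr x A | x A. x \<in> B \<and> A \<in> sets M} r \<le> - enn2ereal (S B r)"
    (is "L ?B' r \<le> _") if B: "B \<in> \<B>" and ne: "B \<noteq> {}" and r: "0 < r" for B r
  proof -
    have B': "?B' \<subseteq> X"
      using assms(7) B by (intro sub) (auto simp: solid_def)
    have le: "enn2ereal (neg_part_integral M f xs x0 x r) \<le> - L ?B' r" if x: "x \<in> B" for x
    proof -
      define A where "A = {\<omega> \<in> space M. tilted_quotient f xs x0 x r \<omega> < 0}"
      have xX: "x \<in> X"
        using x B sub by auto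
      note [measurable] = tq[OF xX, of r]
      have "A \<in> sets M"
        unfolding A_def by measurable
      then have xA: "restr x A \<in> ?B'"
        using x by auto
      then have "L ?B' r \<le> functional_quotient J x0 (restr x A) r - ereal (pairing M xs (restr x A))"
        unfolding L_def by (rule INF_lower)
      also have "\<dots> = upper_integral M (tilted_quotient f xs x0 (restr x A) r)"
        using subsetD[OF B' xA] r by (rule quot)
      also have "\<dots> = - enn2ereal (neg_part_integral M f xs x0 x r)"
        unfolding A_def using xX assms(8) fin
        by (intro neg_part_integral_eq_upper_integral_restr assms(5) meas
            borel_measurable_integrable int)
      finally show ?thesis
        by (subst ereal_le_uminus_swap)
    qed
    have "neg_part_integral M f xs x0 x r \<le> e2ennreal (- L ?B' r)" if "x \<in> B" for x
      using e2ennreal_mono[OF le[OF that]] by simp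
    then have "S B r \<le> e2ennreal (- L ?B' r)"
      unfolding S_def by (rule SUP_least)
    moreover have "0 \<le> - L ?B' r"
    proof -
      obtain x where "x \<in> B"
        using ne by auto
      from order_trans[OF enn2ereal_nonneg le[OF this]] show ?thesis .
    qed
    ultimately have "enn2ereal (S B r) \<le> - L ?B' r"
      by (simp add: less_eq_ennreal.rep_eq enn2ereal_e2ennreal)
    then show ?thesis
      by (subst ereal_le_uminus_swap)
  qed
  have pos: "\<forall>\<^sub>F r in at_right 0. 0 < (r::real)"
    by (rule eventually_at_right_less)
  have "subderivative X N \<B> J x0 (pairing M xs) \<longleftrightarrow> (\<forall>B\<in>\<B>. 0 \<le> Liminf (at_right 0) (L B))"
    using assms(8-10) unfolding subderivative_def L_def J_def integral_dual_def by auto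
  also have "\<dots> \<longleftrightarrow> (\<forall>B\<in>\<B>. (S B \<longlongrightarrow> 0) (at_right 0))"
  proof (intro iffI ballI)
    fix B assume a: "\<forall>B\<in>\<B>. 0 \<le> Liminf (at_right 0) (L B)" and B: "B \<in> \<B>"
    show "(S B \<longlongrightarrow> 0) (at_right 0)"
    proof (cases "B = {}")
      case True
      then show ?thesis
        by (simp add: S_def[abs_def] bot_ennreal)
    next
      case False
      have "0 \<le> Liminf (at_right 0) (L {restr x A | x A. x \<in> B \<and> A \<in> sets M})"
        using a B assms(7) by (auto simp: solid_def)
      also have "\<dots> \<le> Liminf (at_right 0) (\<lambda>r. - enn2ereal (S B r))"
        using pos by (intro Liminf_mono) (auto elim!: eventually_mono intro: upper[OF B False])
      finally show ?thesis
        by (subst tendsto_0_iff_Liminf_uminus_enn2ereal) simp_all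
    qed
  next
    fix B assume b: "\<forall>B\<in>\<B>. (S B \<longlongrightarrow> 0) (at_right 0)" and B: "B \<in> \<B>"
    then have "0 \<le> Liminf (at_right 0) (\<lambda>r. - enn2ereal (S B r))"
      by (subst tendsto_0_iff_Liminf_uminus_enn2ereal[symmetric]) simp_all
    also have "\<dots> \<le> Liminf (at_right 0) (L B)"
      using pos by (intro Liminf_mono) (auto elim!: eventually_mono intro: lower[OF B])
    finally show "0 \<le> Liminf (at_right 0) (L B)" .
  qed
  finally show ?thesis
    unfolding J_def S_def neg_part_integral_def .
qed

end
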